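(* Let $T$ be a tree with $m$ edges, with bipartition classes $T_A$ and $T_B$, and let $G$ be a bipartite graph with bipartition classes $A$ and $B$ that admits a $T$-equitable colouring $\phi: E(G)\to E(T)$. If for every vertex $v\in V(G)$ and every colour $j\in E(T)$ we have $d_j(v)\ge 10^{50m}$ (i.e. the minimum degree in each colour is at least $10^{50m}$), then $G$ has a $T$-decomposition.
   Context: All graphs are finite and simple. A vertex $v\in V(G)$ and a vertex $t\in V(T)$ are compatible if $v\in A$ and $t\in T_A$, or $v\in B$ and $t\in T_B$. For an (improper) edge-colouring $\phi:E(G)\to E(T)$, $d_j(v)$ denotes the number of edges of colour $j$ incident with $v$, and $S(t)$ denotes the set of edges of $T$ incident with $t\in V(T)$. The colouring $\phi$ is $T$-equitable if for all compatible $v\in V(G)$, $t\in V(T)$ and all $j,k\in S(t)$ we have $d_j(v)=d_k(v)$. A $T$-decomposition of $G$ is a partition of $E(G)$ into parts each inducing a subgraph isomorphic to $T$. *)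

theory Defs
  imports Main "HOL-Library.Disjoint_Sets"
begin

definition simple_graph :: "'a set \<Rightarrow> 'a set set \<Rightarrow> bool" where
  "simple_graph V E \<longleftrightarrow> finite V \<and> (\<forall>e\<in>E. e \<subseteq> V \<and> card e = 2)"

definition adj :: "'a set set \<Rightarrow> 'a \<Rightarrow> 'a \<Rightarrow> bool" where
  "adj E x y \<longleftrightarrow> {x, y} \<in> E"

definition connected_graph :: "'a set \<Rightarrow> 'a set set \<Rightarrow> bool" where
  "connected_graph V E \<longleftrightarrow> V \<noteq> {} \<and> (\<forall>u\<in>V. \<forall>v\<in>V. (adj E)\<^sup>*\<^sup>* u v)"

definition is_cycle :: "'a set set \<Rightarrow> 'a list \<Rightarrow> bool" where
  "is_cycle E cs \<longleftrightarrow> length cs \<ge> 3 \<and> distinct cs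
     \<and> (\<forall>i. Suc i < length cs \<longrightarrow> adj E (cs ! i) (cs ! Suc i))
     \<and> adj E (last cs) (hd cs)"

definition tree :: "'a set \<Rightarrow> 'a set set \<Rightarrow> bool" where
  "tree V E \<longleftrightarrow> simple_graph V E \<and> connected_graph V E \<and> (\<nexists>cs. is_cycle E cs)"

definition bipartition :: "'a set \<Rightarrow> 'a set set \<Rightarrow> 'a set \<Rightarrow> 'a set \<Rightarrow> bool" where
  "bipartition V E X Y \<longleftrightarrow> X \<union> Y = V \<and> X \<inter> Y = {}
     \<and> (\<forall>e\<in>E. \<exists>x\<in>X. \<exists>y\<in>Y. e = {x, y})"

definition col_deg :: "'v set set \<Rightarrow> ('v set \<Rightarrow> 't set) \<Rightarrow> 't set \<Rightarrow> 'v \<Rightarrow> nat" where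
  "col_deg EG \<phi> j v = card {e \<in> EG. v \<in> e \<and> \<phi> e = j}"

definition S_tree :: "'t set set \<Rightarrow> 't \<Rightarrow> 't set set" where
  "S_tree ET t = {j \<in> ET. t \<in> j}"

definition compatible :: "'v set \<Rightarrow> 'v set \<Rightarrow> 't set \<Rightarrow> 't set \<Rightarrow> 'v \<Rightarrow> 't \<Rightarrow> bool" where
  "compatible A B TA TB v t \<longleftrightarrow> (v \<in> A \<and> t \<in> TA) \<or> (v \<in> B \<and> t \<in> TB)"

definition edge_colouring :: "'v set set \<Rightarrow> 't set set \<Rightarrow> ('v set \<Rightarrow> 't set) \<Rightarrow> bool" where
  "edge_colouring EG ET \<phi> \<longleftrightarrow> (\<forall>e\<in>EG. \<phi> e \<in> ET)"

definition T_equitable ::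
  "'v set \<Rightarrow> 'v set set \<Rightarrow> 'v set \<Rightarrow> 'v set \<Rightarrow> 't set \<Rightarrow> 't set set \<Rightarrow> 't set \<Rightarrow> 't set
    \<Rightarrow> ('v set \<Rightarrow> 't set) \<Rightarrow> bool" where
  "T_equitable VG EG A B VT ET TA TB \<phi> \<longleftrightarrow> edge_colouring EG ET \<phi> \<and>
     (\<forall>v\<in>VG. \<forall>t\<in>VT. compatible A B TA TB v t \<longrightarrow>
        (\<forall>j\<in>S_tree ET t. \<forall>k\<in>S_tree ET t. col_deg EG \<phi> j v = col_deg EG \<phi> k v))"

text \<open>The subgraph (edge-)induced by F, i.e. (\<Union>F, F), is isomorphic to T = (VT, ET).\<close>
definition iso_to :: "'t set \<Rightarrow> 't set set \<Rightarrow> 'v set set \<Rightarrow> bool" where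
  "iso_to VT ET F \<longleftrightarrow> (\<exists>f. bij_betw f VT (\<Union>F) \<and>
      (\<forall>x\<in>VT. \<forall>y\<in>VT. {x, y} \<in> ET \<longleftrightarrow> {f x, f y} \<in> F))"

definition T_decomposition :: "'t set \<Rightarrow> 't set set \<Rightarrow> 'v set set \<Rightarrow> 'v set set set \<Rightarrow> bool" where
  "T_decomposition VT ET EG P \<longleftrightarrow> partition_on EG P \<and> (\<forall>F\<in>P. iso_to VT ET F)"

end

theory Submission
  imports Defs Complex_Main "HOL-Library.FuncSet"
begin

text \<open>
  Equitability allows the edges at each vertex to be grouped so that the edges of the graph
  decompose into homomorphic copies of the tree; the problem is to make all copies injective. We
  apply the lopsided local lemma to a uniformly random decomposition into homomorphic copies. The bad
  events are the individual non-injective copies, and two copies are dependent only if they share an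
  edge: exchanging branches of copies at a common vertex shows that the conditional probability
  of a copy, given that copies edge-disjoint from it are avoided, is at most a product of
  inverse colour degrees. Growing the tree from an edge, these weights sum to at most 1
  over all copies through a fixed edge, and the non-injective ones contribute only
  \<open>|V(T)|\<^sup>2 / D\<close> since the graph is simple, where \<open>D\<close> is the minimum colour degree. As the bound involves
  no maximum degree, no concentration argument is needed.
\<close>

section \<open>Lopsided local lemma in counting form\<close>

text \<open>Conditional probabilities under the uniform measure on \<open>\<Omega>\<close> are
  ratios of cardinalities. Induction on \<open>S\<close> shows that, once all of \<open>S\<close> is
  avoided, \<open>f\<close> occurs with probability at most \<open>2 * p f\<close>. As
  \<open>p f\<close> is at most 1/4, avoiding the events one after another keeps at least half of
  the remaining points each time.\<close>

lemma counting_local_lemma: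
  fixes \<Omega> :: "'p set" and B :: "'b set" and p :: "'b \<Rightarrow> real"
    and occ :: "'p \<Rightarrow> 'b \<Rightarrow> bool" and dep :: "'b \<Rightarrow> 'b \<Rightarrow> bool"
  assumes fin: "finite \<Omega>" "\<Omega> \<noteq> {}" "finite B"
    and pos: "\<And>f. f \<in> B \<Longrightarrow> 0 \<le> p f"
    and refl: "\<And>f. f \<in> B \<Longrightarrow> dep f f"
    and lop: "\<And>f S. f \<in> B \<Longrightarrow> S \<subseteq> B \<Longrightarrow> (\<forall>g\<in>S. \<not> dep f g) \<Longrightarrow>
        real (card {P\<in>\<Omega>. occ P f \<and> (\<forall>g\<in>S. \<not> occ P g)})
        \<le> p f * card {P\<in>\<Omega>. \<forall>g\<in>S. \<not> occ P g}"
    and sum: "\<And>f. f \<in> B \<Longrightarrow> (\<Sum>g\<in>{g\<in>B. dep f g}. p g) \<le> 1/4"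
  shows "\<exists>P\<in>\<Omega>. \<forall>f\<in>B. \<not> occ P f"
proof -
  define N where "N S = real (card {P\<in>\<Omega>. \<forall>g\<in>S. \<not> occ P g})" for S
  define M where "M f S = real (card {P\<in>\<Omega>. occ P f \<and> (\<forall>g\<in>S. \<not> occ P g)})" for f S
  have N_nonneg: "0 \<le> N S" for S by (simp add: N_def)
  have union: "N T \<le> N (T \<union> U) + (\<Sum>g\<in>U. M g T)" if "finite U" for T U
  proof -
    have "{P\<in>\<Omega>. \<forall>g\<in>T. \<not> occ P g} \<subseteq> {P\<in>\<Omega>. \<forall>g\<in>T \<union> U. \<not> occ P g}
        \<union> (\<Union>h\<in>U. {P\<in>\<Omega>. occ P h \<and> (\<forall>g\<in>T. \<not> occ P g)})" by auto
    then have "card {P\<in>\<Omega>. \<forall>g\<in>T. \<not> occ P g} \<le> card ({P\<in>\<Omega>. \<forall>g\<in>T \<union> U. \<not> occ P g}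
        \<union> (\<Union>h\<in>U. {P\<in>\<Omega>. occ P h \<and> (\<forall>g\<in>T. \<not> occ P g)}))"
      using fin that by (intro card_mono) auto
    also have "\<dots> \<le> card {P\<in>\<Omega>. \<forall>g\<in>T \<union> U. \<not> occ P g}
        + card (\<Union>h\<in>U. {P\<in>\<Omega>. occ P h \<and> (\<forall>g\<in>T. \<not> occ P g)})"
      by (rule card_Un_le)
    also have "card (\<Union>h\<in>U. {P\<in>\<Omega>. occ P h \<and> (\<forall>g\<in>T. \<not> occ P g)})
        \<le> (\<Sum>h\<in>U. card {P\<in>\<Omega>. occ P h \<and> (\<forall>g\<in>T. \<not> occ P g)})"
      by (rule card_UN_le[OF that])
    finally show ?thesis unfolding N_def M_def by (simp flip: of_nat_sum of_nat_add)
  qed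
  have key: "M f S \<le> 2 * p f * N S" if "finite S" "f \<in> B" "S \<subseteq> B" for f S
    using that
  proof (induction S arbitrary: f rule: finite_psubset_induct)
    case (psubset S)
    \<comment> \<open>\<open>lop\<close> applies to \<open>S2\<close>; avoiding \<open>S1\<close> in
      addition loses at most half of \<open>N S2\<close>, since twice the weights of
      \<open>S1\<close> sum to at most 1/2.\<close>
    define S1 where "S1 = {g\<in>S. dep f g}"
    define S2 where "S2 = {g\<in>S. \<not> dep f g}"
    have S: "S = S2 \<union> S1" by (auto simp: S1_def S2_def)
    have fin1: "finite S1" using psubset by (simp add: S1_def)
    have "M f S \<le> M f S2"
      unfolding M_def of_nat_le_iff by (rule card_mono) (use fin S in auto)
    also have "\<dots> \<le> p f * N S2"
      unfolding M_def N_def using psubset.prems by (intro lop) (auto simp: S2_def)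
    also have "\<dots> \<le> p f * (2 * N S)"
    proof (rule mult_left_mono)
      \<comment> \<open>Any element of \<open>S1\<close> makes \<open>S2\<close> a proper subset of
        \<open>S\<close>, so the induction hypothesis is available whenever the sum over
        \<open>S1\<close> has a term.\<close>
      have *: "M g S2 \<le> 2 * p g * N S2" if "g \<in> S1" for g
      proof (rule psubset.IH)
        show "S2 \<subset> S" using that by (auto simp: S1_def S2_def)
      qed (use that psubset.prems in \<open>auto simp: S1_def S2_def\<close>)
      have "N S2 \<le> N S + (\<Sum>g\<in>S1. M g S2)" using union[OF fin1] S by simp
      also have "(\<Sum>g\<in>S1. M g S2) \<le> (\<Sum>g\<in>S1. 2 * p g * N S2)" by (rule sum_mono) (rule *)
      also have "\<dots> = 2 * N S2 * (\<Sum>g\<in>S1. p g)"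
        unfolding sum_distrib_left by (intro sum.cong) auto
      also have "(\<Sum>g\<in>S1. p g) \<le> (\<Sum>g\<in>{g\<in>B. dep f g}. p g)"
        using psubset.prems fin pos by (intro sum_mono2) (auto simp: S1_def)
      also have "\<dots> \<le> 1/4" by (rule sum) fact
      finally show "N S2 \<le> 2 * N S" using N_nonneg[of S2] by (simp add: mult_left_mono)
    qed (use pos psubset.prems in auto)
    finally show ?case by simp
  qed
  have p_le: "p f \<le> 1/4" if "f \<in> B" for f
  proof -
    have "p f \<le> (\<Sum>g\<in>{g\<in>B. dep f g}. p g)"
      using that fin pos refl by (intro member_le_sum) auto
    then show ?thesis using sum[OF that] by simp
  qed
  have "N S > 0" if "finite S" "S \<subseteq> B" for S
    using that
  proof (induction S rule: finite_induct)
    case empty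
    then show ?case using fin by (simp add: N_def card_gt_0_iff)
  next
    case (insert f S)
    have "N S \<le> N (S \<union> {f}) + M f S" using union[of "{f}" S] by simp
    moreover have "M f S \<le> 2 * p f * N S" using insert by (intro key) auto
    moreover have "2 * p f * N S \<le> 1/2 * N S"
      using p_le[of f] insert.prems N_nonneg[of S] by (intro mult_right_mono) auto
    moreover have "0 < N S" using insert by simp
    ultimately have "0 < N (S \<union> {f})" by linarith
    then show ?case by simp
  qed
  from this[of B] have "{P\<in>\<Omega>. \<forall>g\<in>B. \<not> occ P g} \<noteq> {}"
    using fin by (auto simp: N_def card_gt_0_iff)
  then show ?thesis by auto
qed

section \<open>Paths, bridges and branches of a tree\<close>

text \<open>When the new first vertex already lies on the path, the part before that occurrence is
  discarded.\<close>

lemma rtranclp_distinct_path: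
  assumes "r\<^sup>*\<^sup>* x y"
  shows "\<exists>xs. xs \<noteq> [] \<and> hd xs = x \<and> last xs = y \<and> distinct xs \<and> successively r xs"
  using assms
proof (induction rule: converse_rtranclp_induct)
  case base
  then show ?case by (intro exI[of _ "[y]"]) auto
next
  case (step x x')
  then obtain xs where xs: "xs \<noteq> []" "hd xs = x'" "last xs = y" "distinct xs" "successively r xs"
    by blast
  show ?case
  proof (cases "x \<in> set xs")
    case True
    then obtain us vs where "xs = us @ x # vs" by (meson split_list)
    then show ?thesis using xs by (intro exI[of _ "x # vs"]) (auto simp: successively_append_iff)
  next
    case False
    then show ?thesis using xs step by (intro exI[of _ "x # xs"]) (auto simp: successively_Cons)
  qed
qed

text \<open>A path from \<open>t\<close> to \<open>s\<close> that avoids the edge would be closed to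
  a cycle by it.\<close>

lemma tree_bridge:
  assumes "tree V E" "{s, t} \<in> E"
  shows "\<not> (adj (E - {{s, t}}))\<^sup>*\<^sup>* t s"
proof
  assume "(adj (E - {{s, t}}))\<^sup>*\<^sup>* t s"
  then obtain xs where xs: "xs \<noteq> []" "hd xs = t" "last xs = s" "distinct xs"
      "successively (adj (E - {{s, t}})) xs"
    using rtranclp_distinct_path by meson
  have "card {s, t} = 2" using assms by (auto simp: tree_def simple_graph_def)
  then have ne: "s \<noteq> t" by auto
  \<comment> \<open>With only two vertices the path would be the deleted edge itself.\<close>
  have "length xs \<ge> 3"
  proof (rule ccontr)
    assume "\<not> length xs \<ge> 3"
    then consider "length xs = 1" | "length xs = 2" using xs(1)
      by (metis One_nat_def Suc_leI le_less_Suc_eq length_greater_0_conv not_less numeral_2_eq_2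
          numeral_3_eq_3 order_neq_le_trans)
    then show False
    proof cases
      case 1
      then show False using xs ne by (auto simp: length_Suc_conv)
    next
      case 2
      then have "xs = [t, s]" using xs by (auto simp: length_Suc_conv numeral_2_eq_2)
      then show False using xs by (auto simp: adj_def insert_commute)
    qed
  qed
  moreover have "adj E (last xs) (hd xs)" using xs assms by (simp add: adj_def)
  moreover have "\<forall>i. Suc i < length xs \<longrightarrow> adj E (xs ! i) (xs ! Suc i)"
    using xs(5) by (auto simp: successively_conv_nth adj_def)
  ultimately have "is_cycle E xs" using xs by (simp add: is_cycle_def)
  then show False using assms by (auto simp: tree_def)
qed

lemma adj_sym: "adj E x y \<longleftrightarrow> adj E y x"
  by (simp add: adj_def insert_commute)

lemma adj_rtranclp_sym: "(adj E)\<^sup>*\<^sup>* x y \<Longrightarrow> (adj E)\<^sup>*\<^sup>* y x"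
  by (metis adj_sym symp_def symp_rtranclp sympD sympI)

lemma adj_rtranclp_mono: "(adj E)\<^sup>*\<^sup>* x y \<Longrightarrow> E \<subseteq> F \<Longrightarrow> (adj F)\<^sup>*\<^sup>* x y"
  by (erule rtranclp_mono[THEN predicate2D, rotated]) (auto simp: adj_def)

text \<open>The component of \<open>t\<close> after deletion of the edge \<open>{s, t}\<close>; two
  copies that agree at \<open>s\<close> can exchange their values here.\<close>

definition branch :: "'t set set \<Rightarrow> 't \<Rightarrow> 't \<Rightarrow> 't set" where
  "branch E s t = {x. (adj (E - {{s, t}}))\<^sup>*\<^sup>* t x}"

lemma branch_edge:
  assumes "{x, y} \<in> E" "{x, y} \<noteq> {s, t}"
  shows "x \<in> branch E s t \<longleftrightarrow> y \<in> branch E s t"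
proof -
  have "adj (E - {{s, t}}) x y" "adj (E - {{s, t}}) y x"
    using assms by (auto simp: adj_def insert_commute)
  then show ?thesis unfolding branch_def by (auto intro: rtranclp.rtrancl_into_rtrancl)
qed

section \<open>Homomorphic copies and pseudo-decompositions\<close>

locale equitable_colouring =
  fixes VT :: "'t set" and ET :: "'t set set" and TA TB :: "'t set"
    and VG :: "'v set" and EG :: "'v set set" and A B :: "'v set"
    and \<phi> :: "'v set \<Rightarrow> 't set"
  assumes tree: "tree VT ET" and bipT: "bipartition VT ET TA TB"
    and simpleG: "simple_graph VG EG" and bipG: "bipartition VG EG A B"
    and equi: "T_equitable VG EG A B VT ET TA TB \<phi>"
begin

abbreviation "cpt \<equiv> compatible A B TA TB"
abbreviation "coldeg \<equiv> col_deg EG \<phi>"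

text \<open>Extensionality turns agreement on \<open>W\<close> into equality. Compatibility fixes
  the orientation, so that an edge of colour \<open>{x, y}\<close> is the image of
  \<open>{x, y}\<close> in one way only. \<open>W\<close> is a parameter because copies are grown
  vertex by vertex.\<close>

definition homs :: "'t set \<Rightarrow> ('t \<Rightarrow> 'v) set" where
  "homs W = {f \<in> W \<rightarrow>\<^sub>E VG. (\<forall>x\<in>W. cpt (f x) x)
     \<and> (\<forall>j\<in>ET. j \<subseteq> W \<longrightarrow> f ` j \<in> EG \<and> \<phi> (f ` j) = j)}"

text \<open>
  Pseudo-decompositions: a homomorphic copy of the tree is represented by its map rather than by its
  edge set, and the maps need not be injective.
\<close>

definition pdecs :: "'t set \<Rightarrow> ('t \<Rightarrow> 'v) set set" where
  "pdecs W = {P. P \<subseteq> homs W \<and> (\<forall>e\<in>EG. \<phi> e \<subseteq> W \<longrightarrow> (\<exists>!f. f \<in> P \<and> f ` \<phi> e = e))}"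

lemma finite_VT: "finite VT" and finite_VG: "finite VG"
  and finite_ET: "finite ET" and finite_EG: "finite EG"
proof -
  show VT: "finite VT" and VG: "finite VG"
    using tree simpleG by (auto simp: tree_def simple_graph_def)
  have "ET \<subseteq> Pow VT" "EG \<subseteq> Pow VG"
    using tree simpleG by (auto simp: tree_def simple_graph_def)
  with VT VG show "finite ET" "finite EG" by (auto dest: finite_subset)
qed

lemma ET_subset: "j \<in> ET \<Longrightarrow> j \<subseteq> VT" and ET_card: "j \<in> ET \<Longrightarrow> card j = 2"
  using tree by (auto simp: tree_def simple_graph_def)

lemma ET_ne: "{x, y} \<in> ET \<Longrightarrow> x \<noteq> y"
  using ET_card by fastforce

lemma ET_eq: "j \<in> ET \<Longrightarrow> j \<subseteq> {x, y} \<Longrightarrow> j = {x, y}"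
  by (rule card_seteq) (auto simp: ET_card card_insert_if)

lemma ETE:
  assumes "j \<in> ET" "x \<in> j"
  obtains y where "j = {x, y}"
  using ET_card[OF assms(1)] assms(2) by (auto simp: card_2_iff)

lemma EG_subset: "e \<in> EG \<Longrightarrow> e \<subseteq> VG"
  using simpleG by (auto simp: simple_graph_def)

lemma col_in_ET: "e \<in> EG \<Longrightarrow> \<phi> e \<in> ET"
  using equi by (auto simp: T_equitable_def edge_colouring_def)

lemma ET_sides: "{x, y} \<in> ET \<Longrightarrow> x \<in> TA \<and> y \<in> TB \<or> x \<in> TB \<and> y \<in> TA"
  using bipT by (auto simp: bipartition_def doubleton_eq_iff dest!: bspec)

lemma cpt_disjoint:
  assumes "{x, y} \<in> ET" "cpt u x"
  shows "\<not> cpt u y"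
  using ET_sides[OF assms(1)] assms(2) bipT bipG
  by (auto simp: compatible_def bipartition_def)

lemma edge_ends:
  assumes "e \<in> EG" "\<phi> e = {x, y}"
  obtains u v where "e = {u, v}" "cpt u x" "cpt v y"
proof -
  from assms bipG obtain u v where "u \<in> A" "v \<in> B" "e = {u, v}"
    by (auto simp: bipartition_def dest!: bspec)
  moreover have "{x, y} \<in> ET" using col_in_ET[OF assms(1)] assms by simp
  ultimately show ?thesis
    using ET_sides[of x y] that[of u v] that[of v u] by (auto simp: compatible_def insert_commute)
qed

lemma edge_end:
  assumes "e \<in> EG" "\<phi> e = {x, y}" "v \<in> e" "cpt v x"
  obtains u where "e = {v, u}" "cpt u y"
proof -
  obtain u' v' where "e = {u', v'}" "cpt u' x" "cpt v' y" using edge_ends assms by metis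
  moreover have "\<not> cpt v y" using assms col_in_ET cpt_disjoint by metis
  ultimately show ?thesis using assms that by auto
qed

lemma homs_cpt: "f \<in> homs W \<Longrightarrow> x \<in> W \<Longrightarrow> cpt (f x) x"
  and homs_VG: "f \<in> homs W \<Longrightarrow> x \<in> W \<Longrightarrow> f x \<in> VG"
  and homs_edge: "f \<in> homs W \<Longrightarrow> j \<in> ET \<Longrightarrow> j \<subseteq> W \<Longrightarrow> f ` j \<in> EG"
  and homs_col: "f \<in> homs W \<Longrightarrow> j \<in> ET \<Longrightarrow> j \<subseteq> W \<Longrightarrow> \<phi> (f ` j) = j"
  by (auto simp: homs_def)

lemma homs_ext: "f \<in> homs W \<Longrightarrow> g \<in> homs W \<Longrightarrow> (\<And>x. x \<in> W \<Longrightarrow> f x = g x) \<Longrightarrow> f = g"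
  by (rule PiE_ext[of f W "\<lambda>_. VG"]) (auto simp: homs_def)

lemma finite_homs:
  assumes "W \<subseteq> VT"
  shows "finite (homs W)"
proof (rule finite_subset)
  show "homs W \<subseteq> W \<rightarrow>\<^sub>E VG" by (auto simp: homs_def)
  show "finite (W \<rightarrow>\<^sub>E VG)" using finite_subset[OF assms finite_VT] finite_VG by (auto intro: finite_PiE)
qed

text \<open>The crossed matching of the ends is impossible, as adjacent tree vertices are compatible
  with opposite classes of the graph.\<close>

lemma cpt_doubleton_eq:
  assumes "{x, y} \<in> ET" "cpt u x" "cpt v y" "cpt u' x" "cpt v' y" "{u, v} = {u', v'}"
  shows "u = u'" "v = v'"
  using cpt_disjoint[OF assms(1)] assms(2-) by (auto simp: doubleton_eq_iff)

lemma homs_eq_on_edge: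
  assumes "f \<in> homs W" "g \<in> homs W'" "j \<in> ET" "j \<subseteq> W" "j \<subseteq> W'" "f ` j = g ` j" "x \<in> j"
  shows "f x = g x"
proof -
  obtain y where y: "j = {x, y}" using ETE assms by metis
  then show ?thesis
    using cpt_doubleton_eq(1)[of x y "f x" "f y" "g x" "g y"] assms by (auto simp: homs_cpt)
qed

lemma pdecs_cover:
  assumes "P \<in> pdecs W" "e \<in> EG" "\<phi> e \<subseteq> W"
  obtains f where "f \<in> P" "f ` \<phi> e = e"
proof -
  have "\<exists>!f. f \<in> P \<and> f ` \<phi> e = e" using assms by (auto simp: pdecs_def)
  then show ?thesis by (elim ex1E conjE) (rule that)
qed

text \<open>Copies in \<open>P\<close> are edge-disjoint: the common image of \<open>j\<close> is an
  edge of colour \<open>j\<close>, and only one copy covers it.\<close>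

lemma pdecs_unique:
  assumes "P \<in> pdecs W" "g \<in> P" "h \<in> P" "j \<in> ET" "j \<subseteq> W" "g ` j = h ` j"
  shows "g = h"
proof -
  have "g \<in> homs W" using assms by (auto simp: pdecs_def)
  then have gj: "g ` j \<in> EG" "\<phi> (g ` j) = j"
    using homs_edge[of g W j] homs_col[of g W j] assms(4,5) by simp_all
  then have "\<exists>!f. f \<in> P \<and> f ` j = g ` j"
    using assms(1,5) by (fastforce simp: pdecs_def)
  then show ?thesis using assms by metis
qed

text \<open>Each edge of this colour at \<open>v\<close> lies in exactly one copy, and compatibility
  of \<open>v\<close> with \<open>s\<close> forces that copy to send \<open>s\<close> to
  \<open>v\<close>.\<close>

lemma bij_at_vertex:
  assumes P: "P \<in> pdecs W" and st: "{s, t} \<in> ET" "{s, t} \<subseteq> W" and v: "cpt v s"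
  shows "bij_betw (\<lambda>h. h ` {s, t}) {h\<in>P. h s = v} {e\<in>EG. v \<in> e \<and> \<phi> e = {s, t}}"
proof (rule bij_betw_imageI)
  have PH: "P \<subseteq> homs W" using P by (simp add: pdecs_def)
  show "inj_on (\<lambda>h. h ` {s, t}) {h\<in>P. h s = v}"
    using pdecs_unique[OF P _ _ st] by (auto simp: inj_on_def)
  show "(\<lambda>h. h ` {s, t}) ` {h\<in>P. h s = v} = {e\<in>EG. v \<in> e \<and> \<phi> e = {s, t}}"
  proof (intro equalityI subsetI)
    fix e assume "e \<in> (\<lambda>h. h ` {s, t}) ` {h\<in>P. h s = v}"
    then show "e \<in> {e\<in>EG. v \<in> e \<and> \<phi> e = {s, t}}"
      using homs_edge[OF _ st] homs_col[OF _ st] PH by auto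
  next
    fix e assume e: "e \<in> {e\<in>EG. v \<in> e \<and> \<phi> e = {s, t}}"
    then obtain f where f: "f \<in> P" "f ` {s, t} = e"
      using P st by (auto simp: pdecs_def)
    obtain u where u: "e = {v, u}" "cpt u t" using e v edge_end by blast
    have "f s = v"
      using cpt_doubleton_eq(1)[OF st(1), of "f s" "f t" v u] f u v st PH homs_cpt[of f W]
      by auto
    then show "e \<in> (\<lambda>h. h ` {s, t}) ` {h\<in>P. h s = v}" using f by blast
  qed
qed

lemma card_at_vertex:
  assumes "P \<in> pdecs W" "{s, t} \<in> ET" "{s, t} \<subseteq> W" "cpt v s"
  shows "card {h\<in>P. h s = v} = coldeg {s, t} v"
  using bij_betw_same_card[OF bij_at_vertex[OF assms]] by (simp add: col_deg_def)

text \<open>Equitability lets a colour already present at \<open>s\<close> be traded for the colour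
  of a new tree edge at \<open>s\<close>.\<close>

lemma coldeg_eq:
  assumes "{s, t} \<in> ET" "{s, t'} \<in> ET" "v \<in> VG" "cpt v s"
  shows "coldeg {s, t} v = coldeg {s, t'} v"
proof -
  have "s \<in> VT" using assms ET_subset by auto
  then show ?thesis using equi assms unfolding T_equitable_def S_tree_def by blast
qed

section \<open>Growing the tree from an edge\<close>

text \<open>
  \<^term>\<open>w f\<close> is the probability that the copy through a given edge coloured \<^term>\<open>{a, b}\<close>
  restricts to \<^term>\<open>f\<close> on \<^term>\<open>W\<close> when the edges at every vertex are matched up at random.
\<close>

inductive grow :: "'t \<Rightarrow> 't \<Rightarrow> 't set \<Rightarrow> (('t \<Rightarrow> 'v) \<Rightarrow> real) \<Rightarrow> bool" for a b where
  base: "grow a b {a, b} (\<lambda>f. 1)"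
| step: "grow a b W w \<Longrightarrow> s \<in> W \<Longrightarrow> t \<notin> W \<Longrightarrow> {s, t} \<in> ET
    \<Longrightarrow> (\<And>j. j \<in> ET \<Longrightarrow> j \<subseteq> insert t W \<Longrightarrow> t \<in> j \<Longrightarrow> j = {s, t})
    \<Longrightarrow> grow a b (insert t W) (\<lambda>f. w f / coldeg {s, t} (f s))"

lemma grow_subset: "grow a b W w \<Longrightarrow> {a, b} \<in> ET \<Longrightarrow> W \<subseteq> VT \<and> {a, b} \<subseteq> W"
  by (induction rule: grow.induct) (use ET_subset in auto)

lemma grow_neighbour: "grow a b W w \<Longrightarrow> {a, b} \<in> ET \<Longrightarrow> x \<in> W \<Longrightarrow> \<exists>y\<in>W. {x, y} \<in> ET"
  by (induction rule: grow.induct) (auto simp: insert_commute)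

lemma grow_nonneg: "grow a b W w \<Longrightarrow> 0 \<le> w f"
proof (induction rule: grow.induct)
  case (step W w s t)
  show ?case using step.IH by simp
qed simp

lemma grow_cong: "grow a b W w \<Longrightarrow> (\<And>x. x \<in> W \<Longrightarrow> f x = g x) \<Longrightarrow> w f = w g"
proof (induction rule: grow.induct)
  case (step W w s t)
  show ?case using step.IH step.prems step.hyps(2) by simp
qed simp

lemma grow_connected:
  assumes "grow a b W w" "{a, b} \<in> ET" "x \<in> W" "y \<in> W"
  shows "(adj {j\<in>ET. j \<subseteq> W})\<^sup>*\<^sup>* x y"
proof -
  have "(adj {j\<in>ET. j \<subseteq> W})\<^sup>*\<^sup>* a x" if "x \<in> W" for x
    using assms(1,2) that
  proof (induction arbitrary: x rule: grow.induct)
    case base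
    then have "adj {j\<in>ET. j \<subseteq> {a, b}} a b" by (auto simp: adj_def)
    with base show ?case by auto
  next
    case (step W w s t)
    have old: "(adj {j\<in>ET. j \<subseteq> insert t W})\<^sup>*\<^sup>* a y" if "y \<in> W" for y
      using step.IH[OF step.prems(1) that] by (rule adj_rtranclp_mono) auto
    have "adj {j\<in>ET. j \<subseteq> insert t W} s t" using step.hyps(2,4) by (auto simp: adj_def)
    with old[OF \<open>s \<in> W\<close>] have "(adj {j\<in>ET. j \<subseteq> insert t W})\<^sup>*\<^sup>* a t" by simp
    with old step.prems show ?case by blast
  qed
  from rtranclp_trans[OF adj_rtranclp_sym[OF this[OF assms(3)]] this[OF assms(4)]] show ?thesis .
qed

lemma grow_connected_avoiding:
  assumes "grow a b W w" "{a, b} \<in> ET" "x \<in> W" "y \<in> W" "t \<notin> W"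
  shows "(adj (ET - {{s, t}}))\<^sup>*\<^sup>* x y"
  using grow_connected[OF assms(1-4)] by (rule adj_rtranclp_mono) (use assms in auto)

text \<open>The grown part is connected by edges other than \<open>{s, t}\<close>, as
  \<open>t\<close> lies outside it. If it met the branch, there would be a route from
  \<open>t\<close> to \<open>s\<close> around the bridge. Hence exchanging branches leaves
  \<open>W\<close> untouched.\<close>

lemma grow_branch:
  assumes "grow a b W w" "{a, b} \<in> ET" "s \<in> W" "t \<notin> W" "{s, t} \<in> ET"
  shows "W \<inter> branch ET s t = {}"
proof (rule ccontr)
  assume "W \<inter> branch ET s t \<noteq> {}"
  then obtain x where x: "x \<in> W" "(adj (ET - {{s, t}}))\<^sup>*\<^sup>* t x" by (auto simp: branch_def)
  then show False
    using rtranclp_trans[OF x(2) grow_connected_avoiding[OF assms(1,2) x(1) assms(3,4)]]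
      tree_bridge[OF tree assms(5)] by blast
qed

text \<open>Connectedness gives an edge leaving \<open>W\<close>; acyclicity allows no second edge
  from its outer end to \<open>W\<close>, as \<open>grow.step\<close> demands.\<close>

lemma grow_extend:
  assumes W: "grow a b W w" "{a, b} \<in> ET" and "W \<noteq> VT"
  shows "\<exists>t w'. t \<in> VT - W \<and> grow a b (insert t W) w'"
proof -
  obtain z where z: "z \<in> VT" "z \<notin> W" using grow_subset[OF W] assms(3) by auto
  have "(adj ET)\<^sup>*\<^sup>* a z"
    using tree z grow_subset[OF W] by (auto simp: tree_def connected_graph_def)
  then have "\<exists>s t. s \<in> W \<and> t \<notin> W \<and> {s, t} \<in> ET"
    using z(2)
  proof (induction rule: rtranclp_induct)
    case base
    then show ?case using grow_subset[OF W] by auto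
  next
    case (step y z)
    then show ?case by (auto simp: adj_def)
  qed
  then obtain s t where st: "s \<in> W" "t \<notin> W" "{s, t} \<in> ET" by blast
  have "j = {s, t}" if j: "j \<in> ET" "j \<subseteq> insert t W" "t \<in> j" for j
  proof (rule ccontr)
    assume ne: "j \<noteq> {s, t}"
    obtain s' where s': "j = {t, s'}" using ETE j by metis
    have "s' \<in> W" using s' j ET_ne[of t s'] by auto
    have "adj (ET - {{s, t}}) t s'" using ne s' j by (auto simp: adj_def)
    then show False
      using converse_rtranclp_into_rtranclp[OF _ grow_connected_avoiding[OF W \<open>s' \<in> W\<close> st(1,2)]]
        tree_bridge[OF tree st(3)] by blast
  qed
  then have "grow a b (insert t W) (\<lambda>f. w f / coldeg {s, t} (f s))"
    by (rule grow.step[OF W(1) st])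
  then show ?thesis using st ET_subset by auto
qed

lemma grow_VT:
  assumes "{a, b} \<in> ET"
  shows "\<exists>w. grow a b VT w"
proof -
  have "\<exists>w'. grow a b VT w'" if "grow a b W w" for W w
    using that
  proof (induction "card (VT - W)" arbitrary: W w rule: less_induct)
    case less
    show ?case
    proof (cases "W = VT")
      case False
      then obtain t w' where t: "t \<in> VT - W" "grow a b (insert t W) w'"
        using grow_extend less.prems assms by blast
      have "card (VT - insert t W) < card (VT - W)"
        using t finite_VT by (intro psubset_card_mono) auto
      then show ?thesis using less.hyps t by blast
    qed (use less in auto)
  qed
  then show ?thesis using grow.base by blast
qed

text \<open>With an edge to grow from, every vertex is reached by growth and so has a
  neighbour.\<close>

lemma Union_ET:
  assumes "ET \<noteq> {}"
  shows "\<Union>ET = VT"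
proof
  show "VT \<subseteq> \<Union>ET"
  proof
    fix x assume "x \<in> VT"
    obtain a b w where "{a, b} \<in> ET" "grow a b VT w"
      using assms grow_VT ET_card by (metis card_2_iff ex_in_conv)
    then show "x \<in> \<Union>ET" using grow_neighbour[of a b VT w x] \<open>x \<in> VT\<close> by auto
  qed
qed (use ET_subset in auto)

section \<open>Existence of pseudo-decompositions\<close>

text \<open>Induction along the growth. When \<open>t\<close> is attached at \<open>s\<close>, the
  copies sending \<open>s\<close> to \<open>v\<close> are as numerous as the edges of colour
  \<open>{s, t}\<close> at \<open>v\<close>, so a bijection at each \<open>v\<close> hands every
  copy its own new edge.\<close>

lemma pdecs_nonempty:
  assumes "grow a b W w" "{a, b} \<in> ET"
  shows "pdecs W \<noteq> {}"
  using assms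
proof (induction rule: grow.induct)
  case base
  have "\<exists>!f. f \<in> homs {a, b} \<and> f ` \<phi> e = e" if e: "e \<in> EG" "\<phi> e \<subseteq> {a, b}" for e
  proof (rule ex_ex1I)
    have col: "\<phi> e = {a, b}" using ET_eq e col_in_ET by blast
    then obtain u v where uv: "e = {u, v}" "cpt u a" "cpt v b" using e edge_ends by metis
    let ?f = "\<lambda>x\<in>{a, b}. if x = a then u else v"
    have "?f ` {a, b} = e" using uv ET_ne[OF base] by auto
    moreover have "?f \<in> homs {a, b}"
      unfolding homs_def using calculation uv EG_subset[OF e(1)] e(1) col ET_ne[OF base]
      by (auto dest: ET_eq)
    ultimately show "\<exists>f. f \<in> homs {a, b} \<and> f ` \<phi> e = e" using col by metis
    fix f g assume "f \<in> homs {a, b} \<and> f ` \<phi> e = e" "g \<in> homs {a, b} \<and> g ` \<phi> e = e"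
    then show "f = g" using homs_eq_on_edge[of f "{a, b}" g "{a, b}" "{a, b}"] base col
      by (intro homs_ext[of f "{a, b}"]) auto
  qed
  then have "homs {a, b} \<in> pdecs {a, b}" by (auto simp: pdecs_def)
  then show ?case by blast
next
  case (step W w s t)
  from step.IH[OF step.prems] obtain P where P: "P \<in> pdecs W" by auto
  have PH: "P \<subseteq> homs W" using P by (simp add: pdecs_def)
  \<comment> \<open>\<open>s'\<close> is an old neighbour of \<open>s\<close>: the copies at
    \<open>v\<close> are counted by colour \<open>{s, s'}\<close>, the new edges by
    \<open>{s, t}\<close>, and equitability equates the two.\<close>
  obtain s' where s': "s' \<in> W" "{s, s'} \<in> ET"
    using grow_neighbour[OF step.hyps(1) step.prems step.hyps(2)] by auto
  have ex_\<beta>: "\<exists>\<beta>. bij_betw \<beta> {h\<in>P. h s = v} {e\<in>EG. v \<in> e \<and> \<phi> e = {s, t}}"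
    if "v \<in> VG" "cpt v s" for v
  proof (rule finite_same_card_bij)
    show "finite {h\<in>P. h s = v}"
      using finite_subset[OF PH finite_homs] grow_subset[OF step.hyps(1) step.prems] by simp
    show "card {h\<in>P. h s = v} = card {e\<in>EG. v \<in> e \<and> \<phi> e = {s, t}}"
      using card_at_vertex[OF P s'(2) _ that(2)] coldeg_eq[OF s'(2) step.hyps(4) that] s' step.hyps(2)
      by (simp add: col_deg_def)
  qed (use finite_EG in auto)
  define \<beta> where "\<beta> v = (SOME \<beta>. bij_betw \<beta> {h\<in>P. h s = v} {e\<in>EG. v \<in> e \<and> \<phi> e = {s, t}})" for v
  have \<beta>: "bij_betw (\<beta> v) {h\<in>P. h s = v} {e\<in>EG. v \<in> e \<and> \<phi> e = {s, t}}"
    if "v \<in> VG" "cpt v s" for v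
    using someI_ex[OF ex_\<beta>[OF that]] by (simp only: \<beta>_def)
  have s_ok: "f s \<in> VG" "cpt (f s) s" if "f \<in> P" for f
    using that PH homs_VG[OF _ step.hyps(2)] homs_cpt[OF _ step.hyps(2)] by auto
  have \<beta>_in: "\<beta> (f s) f \<in> EG" "f s \<in> \<beta> (f s) f" "\<phi> (\<beta> (f s) f) = {s, t}" if "f \<in> P" for f
    using bij_betwE[OF \<beta>[OF s_ok[OF that]]] that by auto
  have "\<forall>f\<in>P. \<exists>y. \<beta> (f s) f = {f s, y} \<and> cpt y t"
  proof
    fix f assume f: "f \<in> P"
    show "\<exists>y. \<beta> (f s) f = {f s, y} \<and> cpt y t"
      by (rule edge_end[OF \<beta>_in(1)[OF f] \<beta>_in(3,2)[OF f] s_ok(2)[OF f]]) auto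
  qed
  \<comment> \<open>\<open>y f\<close> is the far end of the edge assigned to \<open>f\<close>,
    hence the image of \<open>t\<close> under the extended copy.\<close>
  then obtain y where y: "\<And>f. f \<in> P \<Longrightarrow> \<beta> (f s) f = {f s, y f}" "\<And>f. f \<in> P \<Longrightarrow> cpt (y f) t"
    using bchoice[of P "\<lambda>f y. \<beta> (f s) f = {f s, y} \<and> cpt y t"] by auto
  define ext where "ext f = f(t := y f)" for f
  have ne: "s \<noteq> t" using step.hyps(2,3) by auto
  have ext_st: "ext f ` {s, t} = \<beta> (f s) f" if "f \<in> P" for f
    using that ne y by (auto simp: ext_def)
  have ext_old: "ext f ` j = f ` j" if "t \<notin> j" for f j
    unfolding ext_def by (rule image_cong) (use that in auto)
  have ext_homs: "ext f \<in> homs (insert t W)" if "f \<in> P" for f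
  proof -
    have f: "f \<in> homs W" using that PH by auto
    have "y f \<in> VG" using EG_subset[OF \<beta>_in(1)[OF that]] y that by auto
    then have "ext f \<in> insert t W \<rightarrow>\<^sub>E VG"
      unfolding ext_def using f by (intro PiE_fun_upd) (auto simp: homs_def)
    moreover have "\<forall>x\<in>insert t W. cpt (ext f x) x"
      using f y that homs_cpt by (auto simp: ext_def)
    moreover have "ext f ` j \<in> EG \<and> \<phi> (ext f ` j) = j" if j: "j \<in> ET" "j \<subseteq> insert t W" for j
    proof (cases "t \<in> j")
      case True
      then have "j = {s, t}" using step.hyps(5)[OF j] by simp
      then show ?thesis using ext_st[OF \<open>f \<in> P\<close>] \<beta>_in[OF \<open>f \<in> P\<close>] by simp
    next
      case False
      then have "j \<subseteq> W" using j by auto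
      then show ?thesis using ext_old[OF False] homs_edge[OF f] homs_col[OF f] j by simp
    qed
    ultimately show ?thesis by (simp add: homs_def)
  qed
  \<comment> \<open>Edges of the new colour are covered once because \<open>\<beta> v\<close> is a
    bijection; on tree edges avoiding \<open>t\<close> the extension agrees with the old
    copy.\<close>
  have "\<exists>!f. f \<in> ext ` P \<and> f ` \<phi> e = e" if e: "e \<in> EG" "\<phi> e \<subseteq> insert t W" for e
  proof (cases "t \<in> \<phi> e")
    case True
    then have col: "\<phi> e = {s, t}" using step.hyps(5)[OF col_in_ET[OF e(1)] e(2)] by simp
    obtain v u where vu: "e = {v, u}" "cpt v s" "cpt u t" using edge_ends col e by metis
    have v: "v \<in> VG" using vu e EG_subset by blast
    have key: "ext f ` \<phi> e = e \<longleftrightarrow> f s = v \<and> \<beta> v f = e" if "f \<in> P" for f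
    proof
      assume eq: "ext f ` \<phi> e = e"
      then have "{f s, y f} = {v, u}" using col vu that ext_st y by simp
      then have "f s = v"
        using cpt_doubleton_eq(1)[OF step.hyps(4) s_ok(2)[OF that] y(2)[OF that] vu(2,3)] by simp
      then show "f s = v \<and> \<beta> v f = e" using ext_st[OF that] eq col by simp
    qed (use ext_st[OF that] col in auto)
    have "e \<in> \<beta> v ` {h\<in>P. h s = v}"
      using bij_betw_imp_surj_on[OF \<beta>[OF v vu(2)]] e col vu by auto
    then obtain h where h: "h \<in> P" "h s = v" "\<beta> v h = e" by auto
    have inj: "f = g" if "f \<in> P" "f s = v" "g \<in> P" "g s = v" "\<beta> v f = \<beta> v g" for f g
      using bij_betw_imp_inj_on[OF \<beta>[OF v vu(2)]] that by (auto dest: inj_onD)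
    show ?thesis
    proof (rule ex1I[of _ "ext h"])
      show "ext h \<in> ext ` P \<and> ext h ` \<phi> e = e" using h key by blast
      fix f' assume "f' \<in> ext ` P \<and> f' ` \<phi> e = e"
      then obtain f where "f \<in> P" "f' = ext f" "f s = v" "\<beta> v f = e" using key by blast
      then show "f' = ext h" using inj[of f h] h by simp
    qed
  next
    case False
    then have sub: "\<phi> e \<subseteq> W" using e by auto
    obtain h where h: "h \<in> P" "h ` \<phi> e = e" using pdecs_cover[OF P e(1) sub] .
    have uniq: "f = h" if "f \<in> P" "f ` \<phi> e = e" for f
      using pdecs_unique[OF P that(1) h(1) col_in_ET[OF e(1)] sub] that(2) h(2) by simp
    show ?thesis
    proof (rule ex1I[of _ "ext h"])
      show "ext h \<in> ext ` P \<and> ext h ` \<phi> e = e" using h ext_old[OF False] by simp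
      fix f' assume "f' \<in> ext ` P \<and> f' ` \<phi> e = e"
      then obtain f where "f \<in> P" "f' = ext f" "f ` \<phi> e = e" using ext_old[OF False] by auto
      then show "f' = ext h" using uniq[of f] by simp
    qed
  qed
  then have "ext ` P \<in> pdecs (insert t W)" using ext_homs by (auto simp: pdecs_def)
  then show ?case by blast
qed

section \<open>Exchange of branches and the lopsided condition\<close>

text \<open>On every tree edge the new pair covers the same image edges as the old pair, so each
  edge is still covered exactly once. \<open>eq\<close> handles a copy exchanged with itself, which
  must not become two.\<close>

lemma pdecs_exchange:
  assumes P: "P \<in> pdecs W" "g \<in> P" "h \<in> P"
    and H: "g' \<in> homs W" "h' \<in> homs W" and eq: "g = h \<Longrightarrow> g' = h'"
    and sw: "\<And>j. j \<in> ET \<Longrightarrow> j \<subseteq> W \<Longrightarrow>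
      g' ` j = g ` j \<and> h' ` j = h ` j \<or> g' ` j = h ` j \<and> h' ` j = g ` j"
  shows "P - {g, h} \<union> {g', h'} \<in> pdecs W"
proof -
  let ?Q = "P - {g, h} \<union> {g', h'}"
  have "\<exists>!f. f \<in> ?Q \<and> f ` \<phi> e = e" if e: "e \<in> EG" "\<phi> e \<subseteq> W" for e
  proof -
    let ?j = "\<phi> e"
    obtain k where k: "k \<in> P" "k ` ?j = e" using pdecs_cover[OF P(1) e] .
    have uniq: "f = k" if "f \<in> P" "f ` ?j = e" for f
      using pdecs_unique[OF P(1) that(1) k(1) col_in_ET[OF e(1)] e(2)] that(2) k(2) by simp
    note sw' = sw[OF col_in_ET[OF e(1)] e(2)]
    define c where "c = (if k \<notin> {g, h} then k else if g' ` ?j = e then g' else h')"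
    have *: "f = c" if "f \<in> ?Q" "f ` ?j = e" for f
    proof -
      consider "f \<in> P - {g, h}" | "f = g'" | "f = h'" using \<open>f \<in> ?Q\<close> by blast
      then show ?thesis
      proof cases
        case 1
        then have "f = k" using uniq that by simp
        with 1 that show ?thesis by (simp add: c_def)
      next
        case 2
        then have "g ` ?j = e \<or> h ` ?j = e" using sw' that by metis
        then have "k \<in> {g, h}" using uniq P by auto
        then show ?thesis using 2 that by (simp add: c_def)
      next
        case 3
        then have "g ` ?j = e \<or> h ` ?j = e" using sw' that by metis
        then have k': "k \<in> {g, h}" using uniq P by auto
        \<comment> \<open>If both new copies cover \<open>e\<close>, then so did both old ones, and
          uniqueness in \<open>P\<close> makes these equal.\<close>
        have "g' = h'" if "g' ` ?j = e"
        proof -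
          have "g ` ?j = e" "h ` ?j = e" using sw' that 3 \<open>f ` ?j = e\<close> by metis+
          then have "g = h" using uniq[of g] uniq[of h] P by simp
          then show ?thesis by (rule eq)
        qed
        then show ?thesis using 3 k' that by (simp add: c_def)
      qed
    qed
    have "g' ` ?j = e \<or> h' ` ?j = e" if "k \<in> {g, h}" using that sw' k(2) by (metis insert_iff empty_iff)
    then have "c ` ?j = e" using k(2) by (simp add: c_def) blast
    moreover have "c \<in> ?Q" using k(1) by (simp add: c_def)
    ultimately show ?thesis using * by (intro ex1I[of _ c]) blast+
  qed
  moreover have "?Q \<subseteq> homs W" using P H by (auto simp: pdecs_def)
  ultimately show ?thesis by (simp add: pdecs_def)
qed

definition swap :: "'t set \<Rightarrow> ('t \<Rightarrow> 'v) \<Rightarrow> ('t \<Rightarrow> 'v) \<Rightarrow> 't \<Rightarrow> 'v" where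
  "swap X g h = (\<lambda>x. if x \<in> X then h x else g x)"

text \<open>The exchange is an involution on ordered pairs; the injectivity of the counting map in
  \<open>swapping_bound\<close> rests on this.\<close>

lemma swap_swap: "swap X (swap X g h) (swap X h g) = g"
  by (auto simp: swap_def)

text \<open>A tree edge other than \<open>{s, t}\<close> lies entirely inside or entirely outside
  the branch. On \<open>{s, t}\<close> the values at \<open>s\<close> coincide, so the exchange at
  \<open>t\<close> moves the whole image edge.\<close>

lemma swap_edge:
  assumes "g s = h s" "{s, t} \<in> ET" "j \<in> ET"
  defines "X \<equiv> branch ET s t"
  shows "swap X g h ` j = g ` j \<and> swap X h g ` j = h ` j
    \<or> swap X g h ` j = h ` j \<and> swap X h g ` j = g ` j"
proof -
  have "t \<in> X" "s \<notin> X" using tree_bridge[OF tree assms(2)] by (auto simp: X_def branch_def)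
  obtain x y where j: "j = {x, y}" using ET_card[OF assms(3)] by (auto simp: card_2_iff)
  show ?thesis
  proof (cases "j = {s, t}")
    case True
    then show ?thesis using \<open>t \<in> X\<close> \<open>s \<notin> X\<close> assms(1) by (auto simp: swap_def)
  next
    case False
    then have "x \<in> X \<longleftrightarrow> y \<in> X"
      unfolding X_def using branch_edge assms(3) j by metis
    then show ?thesis using j by (cases "x \<in> X") (auto simp: swap_def)
  qed
qed

lemma swap_homs:
  assumes "g \<in> homs VT" "h \<in> homs VT" "g s = h s" "{s, t} \<in> ET"
  shows "swap (branch ET s t) g h \<in> homs VT"
proof -
  let ?g = "swap (branch ET s t) g h"
  have "?g \<in> VT \<rightarrow>\<^sub>E VG"
    using assms(1,2) by (auto simp: homs_def swap_def PiE_iff extensional_def)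
  moreover have "\<forall>x\<in>VT. cpt (?g x) x"
    using assms(1,2) by (auto simp: homs_def swap_def)
  moreover have "?g ` j \<in> EG \<and> \<phi> (?g ` j) = j" if "j \<in> ET" for j
  proof -
    have "?g ` j = g ` j \<or> ?g ` j = h ` j" using swap_edge[of g s h t j, OF assms(3,4) that] by blast
    then show ?thesis
      using homs_edge[OF assms(1) that] homs_edge[OF assms(2) that]
        homs_col[OF assms(1) that] homs_col[OF assms(2) that] ET_subset[OF that] by auto
  qed
  ultimately show ?thesis by (simp add: homs_def)
qed

lemma finite_pdecs: "finite (pdecs VT)"
  by (rule finite_subset[of _ "Pow (homs VT)"]) (auto simp: pdecs_def finite_homs)

text \<open>
  The lopsided dependency condition. If the copy \<^term>\<open>g\<close> agrees with \<^term>\<open>f\<close> on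
  \<^term>\<open>insert t W\<close>, exchange the branches beyond \<^term>\<open>{s, t}\<close> of \<^term>\<open>g\<close> and of any of the
  \<^term>\<open>coldeg {s, t} (f s)\<close> copies through \<^term>\<open>f s\<close>. Both new copies share an edge with
  \<^term>\<open>f\<close>, so neither lies in \<^term>\<open>S\<close>, and the exchange can be undone.
\<close>

lemma swapping_bound:
  assumes ab: "{a, b} \<in> ET" and f: "f \<in> homs VT"
    and S: "\<And>g j. g \<in> S \<Longrightarrow> j \<in> ET \<Longrightarrow> g ` j \<noteq> f ` j"
    and grow: "grow a b W w"
  shows "real (card {P\<in>pdecs VT. P \<inter> S = {} \<and> (\<exists>g\<in>P. \<forall>x\<in>W. g x = f x)})
    \<le> w f * card {P\<in>pdecs VT. P \<inter> S = {}}"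
  using grow
proof (induction rule: grow.induct)
  case base
  have "card {P\<in>pdecs VT. P \<inter> S = {} \<and> (\<exists>g\<in>P. \<forall>x\<in>{a, b}. g x = f x)}
      \<le> card {P\<in>pdecs VT. P \<inter> S = {}}"
    by (rule card_mono) (use finite_pdecs in auto)
  then show ?case by simp
next
  case (step W w s t)
  define X where "X W = {P\<in>pdecs VT. P \<inter> S = {} \<and> (\<exists>g\<in>P. \<forall>x\<in>W. g x = f x)}" for W
  define br where "br = branch ET s t"
  note st = step.hyps(4)
  have sub: "{a, b} \<subseteq> W" "W \<subseteq> VT" using grow_subset[OF step.hyps(1) ab] by auto
  have stV: "{s, t} \<subseteq> VT" and abV: "{a, b} \<subseteq> VT" using ET_subset[OF st] ET_subset[OF ab] by auto
  have brW: "W \<inter> br = {}"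
    unfolding br_def using grow_branch[OF step.hyps(1) ab step.hyps(2,3) st] .
  have t_br: "t \<in> br" by (simp add: br_def branch_def)
  have s_br: "s \<notin> br" using brW step.hyps(2) by auto
  have fs: "cpt (f s) s" using homs_cpt[OF f] stV by auto
  have "\<forall>P\<in>X (insert t W). \<exists>g\<in>P. \<forall>x\<in>insert t W. g x = f x" by (simp add: X_def)
  then obtain \<gamma> where \<gamma>: "\<And>P. P \<in> X (insert t W) \<Longrightarrow> \<gamma> P \<in> P"
      "\<And>P x. P \<in> X (insert t W) \<Longrightarrow> x \<in> insert t W \<Longrightarrow> \<gamma> P x = f x"
    using bchoice[of "X (insert t W)" "\<lambda>P g. g \<in> P \<and> (\<forall>x\<in>insert t W. g x = f x)"]
    by (auto simp: Bex_def)
  \<comment> \<open>Double counting: each \<open>P\<close> contributes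
    \<open>coldeg {s, t} (f s)\<close> pairs, and \<open>\<psi>\<close> maps the pairs injectively
    into \<open>X W\<close>. The choice \<open>h = \<gamma> P\<close> is included and leaves
    \<open>P\<close> unchanged.\<close>
  define Q where "Q = (SIGMA P:X (insert t W). {h\<in>P. h s = f s})"
  define new1 where "new1 = (\<lambda>(P, h). swap br (\<gamma> P) h)"
  define new2 where "new2 = (\<lambda>(P, h). swap br h (\<gamma> P))"
  define \<psi> where "\<psi> = (\<lambda>(P, h). P - {\<gamma> P, h} \<union> {new1 (P, h), new2 (P, h)})"
  have finX: "finite (X V)" for V using finite_pdecs by (simp add: X_def)
  have facts: "P \<in> pdecs VT" "P \<subseteq> homs VT" "P \<inter> S = {}" "\<gamma> P \<in> P" "h \<in> P" "h s = f s" "\<gamma> P s = h s"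
    if "(P, h) \<in> Q" for P h
    using that \<gamma>[of P] step.hyps(2) by (auto simp: Q_def X_def pdecs_def)
  \<comment> \<open>\<open>new1\<close> keeps the edge of \<open>f\<close> at \<open>{a, b}\<close>
    and \<open>new2\<close> receives the one at \<open>{s, t}\<close>. Hence both avoid
    \<open>S\<close>, and each can be identified in \<open>\<psi> (P, h)\<close> by that
    edge.\<close>
  have new1_W: "new1 (P, h) x = f x" if "(P, h) \<in> Q" "x \<in> W" for P h x
    using that \<gamma>(2)[of P x] brW by (auto simp: new1_def swap_def Q_def)
  have new1_ab: "new1 (P, h) ` {a, b} = f ` {a, b}" if "(P, h) \<in> Q" for P h
    using new1_W[OF that] sub by simp
  have new2_st: "new2 (P, h) ` {s, t} = f ` {s, t}" if "(P, h) \<in> Q" for P h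
    using that facts(6)[OF that] \<gamma>(2)[of P t] t_br s_br by (auto simp: new2_def swap_def Q_def)
  have new_homs: "new1 (P, h) \<in> homs VT" "new2 (P, h) \<in> homs VT" if "(P, h) \<in> Q" for P h
    using facts[OF that] swap_homs[of "\<gamma> P" h s t] swap_homs[of h "\<gamma> P" s t] st
    by (auto simp: new1_def new2_def br_def)
  have \<psi>_pdecs: "\<psi> (P, h) \<in> pdecs VT" if "(P, h) \<in> Q" for P h
    unfolding \<psi>_def prod.case
  proof (rule pdecs_exchange)
    show "P \<in> pdecs VT" "\<gamma> P \<in> P" "h \<in> P" using facts[OF that] by auto
    show "new1 (P, h) \<in> homs VT" "new2 (P, h) \<in> homs VT" using new_homs[OF that] by auto
    show "new1 (P, h) = new2 (P, h)" if "\<gamma> P = h" using that by (simp add: new1_def new2_def)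
    show "new1 (P, h) ` j = \<gamma> P ` j \<and> new2 (P, h) ` j = h ` j
        \<or> new1 (P, h) ` j = h ` j \<and> new2 (P, h) ` j = \<gamma> P ` j" if "j \<in> ET" "j \<subseteq> VT" for j
      using swap_edge[of "\<gamma> P" s h t j, OF facts(7)[OF \<open>(P, h) \<in> Q\<close>] st that(1)]
      by (simp add: new1_def new2_def br_def)
  qed
  have "\<psi> ` Q \<subseteq> X W"
  proof (clarify)
    fix P h assume Q: "(P, h) \<in> Q"
    have "new1 (P, h) \<notin> S" using S ab new1_ab[OF Q] by blast
    moreover have "new2 (P, h) \<notin> S" using S st new2_st[OF Q] by blast
    ultimately have "\<psi> (P, h) \<inter> S = {}" using facts(3)[OF Q] by (auto simp: \<psi>_def)
    moreover have "new1 (P, h) \<in> \<psi> (P, h)" by (simp add: \<psi>_def)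
    ultimately show "\<psi> (P, h) \<in> X W" using \<psi>_pdecs[OF Q] new1_W[OF Q] by (auto simp: X_def)
  qed
  moreover have "inj_on \<psi> Q"
  proof (rule inj_onI, clarify)
    \<comment> \<open>A new copy that was already in \<open>P\<close> shares an edge with
      \<open>\<gamma> P\<close> and so equals it; thus removing the new copies loses nothing that is
      not put back.\<close>
    have recover: "P = \<psi> (P, h) - {new1 (P, h), new2 (P, h)} \<union> {\<gamma> P, h}" if Q: "(P, h) \<in> Q" for P h
    proof -
      have "new1 (P, h) = \<gamma> P" if "new1 (P, h) \<in> P"
        using pdecs_unique[OF facts(1)[OF Q] that facts(4)[OF Q] ab abV] new1_ab[OF Q]
          \<gamma>(2)[of P] Q sub by (simp add: Q_def)
      moreover have "new2 (P, h) = \<gamma> P" if "new2 (P, h) \<in> P"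
        using pdecs_unique[OF facts(1)[OF Q] that facts(4)[OF Q] st stV] new2_st[OF Q]
          \<gamma>(2)[of P] Q step.hyps(2) by (simp add: Q_def)
      ultimately show ?thesis
        using facts(4,5)[OF Q] unfolding \<psi>_def prod.case by blast
    qed
    fix P1 h1 P2 h2
    assume Q: "(P1, h1) \<in> Q" "(P2, h2) \<in> Q" and eq: "\<psi> (P1, h1) = \<psi> (P2, h2)"
    have mem: "new1 (P, h) \<in> \<psi> (P, h)" "new2 (P, h) \<in> \<psi> (P, h)" for P h by (auto simp: \<psi>_def)
    have 1: "new1 (P1, h1) = new1 (P2, h2)"
      using mem(1)[of P2 h2] new1_ab[OF Q(1)] new1_ab[OF Q(2)]
      by (intro pdecs_unique[OF \<psi>_pdecs[OF Q(1)] mem(1) _ ab abV]) (simp_all add: eq)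
    have 2: "new2 (P1, h1) = new2 (P2, h2)"
      using mem(2)[of P2 h2] new2_st[OF Q(1)] new2_st[OF Q(2)]
      by (intro pdecs_unique[OF \<psi>_pdecs[OF Q(1)] mem(2) _ st stV]) (simp_all add: eq)
    have "\<gamma> P = swap br (new1 (P, h)) (new2 (P, h))" "h = swap br (new2 (P, h)) (new1 (P, h))" for P h
      by (simp_all add: new1_def new2_def swap_swap)
    then have "\<gamma> P1 = \<gamma> P2" "h1 = h2" using 1 2 by metis+
    then show "P1 = P2 \<and> h1 = h2" using recover[OF Q(1)] recover[OF Q(2)] 1 2 eq by simp
  qed
  ultimately have "card Q \<le> card (X W)" using finX by (intro card_inj_on_le)
  also have "card Q = (\<Sum>P\<in>X (insert t W). card {h\<in>P. h s = f s})"
    unfolding Q_def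
  proof (intro card_SigmaI finX ballI)
    fix P assume "P \<in> X (insert t W)"
    then have "P \<subseteq> homs VT" by (auto simp: X_def pdecs_def)
    then show "finite {h\<in>P. h s = f s}"
      using finite_subset[OF _ finite_homs] by auto
  qed
  also have "\<dots> = (\<Sum>P\<in>X (insert t W). coldeg {s, t} (f s))"
    using card_at_vertex[OF _ st stV fs] by (intro sum.cong) (auto simp: X_def)
  finally have le: "card (X (insert t W)) * coldeg {s, t} (f s) \<le> card (X W)" by simp
  \<comment> \<open>\<open>f\<close> itself supplies an edge of this colour at \<open>f s\<close>,
    so the degree is a legitimate divisor.\<close>
  have "f ` {s, t} \<in> {e\<in>EG. f s \<in> e \<and> \<phi> e = {s, t}}"
    using homs_edge[OF f st stV] homs_col[OF f st stV] by simp
  then have "coldeg {s, t} (f s) > 0"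
    unfolding col_deg_def using finite_EG by (auto simp: card_gt_0_iff)
  then have "real (card (X (insert t W))) \<le> card (X W) / coldeg {s, t} (f s)"
    using le by (simp add: pos_le_divide_eq flip: of_nat_mult)
  also have "\<dots> \<le> (w f * card {P\<in>pdecs VT. P \<inter> S = {}}) / coldeg {s, t} (f s)"
    using step.IH by (intro divide_right_mono) (auto simp: X_def)
  finally show ?case by (simp add: X_def)
qed

section \<open>Weight of the non-injective copies\<close>

text \<open>
  Where the minimum degree enters: when \<^term>\<open>t\<close> is attached at \<^term>\<open>s\<close>, at most
  \<^term>\<open>card W\<close> of the at least \<^term>\<open>D\<close> equally likely edges lead to a vertex already used.
\<close>

lemma weight_sum:
  assumes grow: "grow a b W w" and ab: "{a, b} \<in> ET"
    and D: "D > 0" "\<And>v j. v \<in> VG \<Longrightarrow> j \<in> ET \<Longrightarrow> D \<le> coldeg j v"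
  shows "(\<Sum>f\<in>{f\<in>homs W. f ` {a, b} = e}. w f) \<le> 1
    \<and> (\<Sum>f\<in>{f\<in>homs W. f ` {a, b} = e \<and> \<not> inj_on f W}. w f) \<le> (card W)\<^sup>2 / real D"
  using grow
proof (induction rule: grow.induct)
  case base
  have "f = g" if "f \<in> {f\<in>homs {a, b}. f ` {a, b} = e}" "g \<in> {f\<in>homs {a, b}. f ` {a, b} = e}" for f g
    using that homs_eq_on_edge[of f "{a, b}" g "{a, b}" "{a, b}"] ab
    by (intro homs_ext[of f "{a, b}" g]) auto
  moreover have "finite {f\<in>homs {a, b}. f ` {a, b} = e}"
    using finite_homs[OF ET_subset[OF ab]] by simp
  ultimately have le1: "card {f\<in>homs {a, b}. f ` {a, b} = e} \<le> Suc 0"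
    by (intro iffD2[OF card_le_Suc0_iff_eq] ballI) blast+
  have "inj_on f {a, b}" if "f \<in> homs {a, b}" for f
    using cpt_disjoint[OF ab homs_cpt[OF that, of a]] homs_cpt[OF that, of b] by (auto simp: inj_on_def)
  then have no_bad: "{f\<in>homs {a, b}. f ` {a, b} = e \<and> \<not> inj_on f {a, b}} = {}" by blast
  show ?case unfolding no_bad using le1 by simp
next
  case (step W w s t)
  note st = step.hyps(4)
  define w' where "w' f = w f / coldeg {s, t} (f s)" for f
  define H where "H = {f\<in>homs W. f ` {a, b} = e}"
  define H' where "H' = {f\<in>homs (insert t W). f ` {a, b} = e}"
  define bad where "bad = {f\<in>homs W. f ` {a, b} = e \<and> \<not> inj_on f W}"
  define bad' where "bad' = {f\<in>homs (insert t W). f ` {a, b} = e \<and> \<not> inj_on f (insert t W)}"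
  \<comment> \<open>The possible images of \<open>t\<close> once \<open>f\<close> is fixed on
    \<open>W\<close>; as there are no parallel edges, distinct images use distinct edges at
    \<open>f s\<close>.\<close>
  define N where "N f = {y. {f s, y} \<in> EG \<and> \<phi> {f s, y} = {s, t}}" for f
  have sub: "{a, b} \<subseteq> W" "W \<subseteq> VT" using grow_subset[OF step.hyps(1) ab] by auto
  have t: "t \<in> VT" using ET_subset[OF st] by auto
  have finW: "finite W" using sub finite_VT finite_subset by auto
  have finH: "finite H" "finite bad" "finite H'" "finite bad'"
    using finite_homs[OF sub(2)] finite_homs[of "insert t W"] t sub(2)
    by (auto simp: H_def H'_def bad_def bad'_def)
  have fin_N: "finite (N f)" for f
  proof (rule finite_subset)
    show "N f \<subseteq> VG" using EG_subset by (auto simp: N_def)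
  qed (rule finite_VG)
  have card_N: "card (N f) \<le> coldeg {s, t} (f s)" for f
    unfolding col_deg_def
  proof (rule card_inj_on_le[of "\<lambda>y. {f s, y}"])
    show "inj_on (\<lambda>y. {f s, y}) (N f)" by (auto simp: inj_on_def doubleton_eq_iff)
  qed (use finite_EG in \<open>auto simp: N_def\<close>)
  have coldeg: "D \<le> coldeg {s, t} (f s)" if "f \<in> homs W" for f
    using D(2)[OF homs_VG[OF that step.hyps(2)] st] .
  have restrict: "restrict f W \<in> H" "f t \<in> N (restrict f W)" if "f \<in> H'" for f
  proof -
    have f: "f \<in> homs (insert t W)" using that by (simp add: H'_def)
    have img: "restrict f W ` j = f ` j" if "j \<subseteq> W" for j
      using that by (intro image_cong) auto
    then have "restrict f W \<in> homs W" using f by (auto simp: homs_def)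
    then show "restrict f W \<in> H" using that sub(1) by (simp add: H_def H'_def)
    show "f t \<in> N (restrict f W)"
      using homs_edge[OF f st] homs_col[OF f st] step.hyps(2) by (simp add: N_def)
  qed
  have inj: "inj_on (\<lambda>f. (restrict f W, f t)) X" if "X \<subseteq> H'" for X
  proof (rule inj_onI)
    fix f g assume "f \<in> X" "g \<in> X" "(restrict f W, f t) = (restrict g W, g t)"
    then show "f = g"
      using that by (intro homs_ext[of f "insert t W" g]) (auto simp: H'_def dest: fun_cong split: if_splits)
  qed
  \<comment> \<open>An extension is determined by its restriction and the image of \<open>t\<close>,
    and its weight depends on the restriction alone. Hence the extensions of \<open>f\<close> that
    send \<open>t\<close> into \<open>M f\<close> weigh at most
    \<open>card (M f) / coldeg {s, t} (f s)\<close> times \<open>w f\<close>.\<close>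
  have bound: "(\<Sum>f\<in>X. w' f) \<le> c * (\<Sum>f\<in>U. w f)"
    if X: "X \<subseteq> H'" "\<And>f. f \<in> X \<Longrightarrow> restrict f W \<in> U \<and> f t \<in> M (restrict f W)"
      and U: "finite U" "\<And>f. finite (M f)"
      and c: "\<And>f. f \<in> U \<Longrightarrow> card (M f) / coldeg {s, t} (f s) \<le> c" for X U M c
  proof -
    define h where "h = (\<lambda>(f, y::'v). w' f)"
    have w'_nonneg: "0 \<le> w' f" for f using grow_nonneg[OF step.hyps(1)] by (simp add: w'_def)
    have "(\<Sum>f\<in>X. w' f) = (\<Sum>f\<in>X. h (restrict f W, f t))"
    proof (rule sum.cong)
      fix f assume "f \<in> X"
      show "w' f = h (restrict f W, f t)"
        using grow_cong[OF step.hyps(1), of f "restrict f W"] step.hyps(2) by (simp add: h_def w'_def)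
    qed simp
    also have "\<dots> = sum h ((\<lambda>f. (restrict f W, f t)) ` X)"
      using sum.reindex[OF inj[OF X(1)], of h] by simp
    also have "\<dots> \<le> sum h (Sigma U M)"
      using U X(2) w'_nonneg by (intro sum_mono2) (auto simp: h_def)
    also have "\<dots> = (\<Sum>f\<in>U. \<Sum>y\<in>M f. w' f)"
      unfolding h_def using U by (intro sum.Sigma[symmetric]) auto
    also have "\<dots> = (\<Sum>f\<in>U. (card (M f) / coldeg {s, t} (f s)) * w f)"
      by (simp add: w'_def mult_ac)
    also have "\<dots> \<le> (\<Sum>f\<in>U. c * w f)"
      using c grow_nonneg[OF step.hyps(1)] by (intro sum_mono mult_right_mono)
    finally show ?thesis by (simp add: sum_distrib_left)
  qed
  have IH: "(\<Sum>f\<in>H. w f) \<le> 1" "(\<Sum>f\<in>bad. w f) \<le> (card W)\<^sup>2 / real D"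
    using step.IH by (auto simp: H_def bad_def)
  have ratio: "card (N f) / coldeg {s, t} (f s) \<le> 1" for f
    using card_N[of f] by (auto simp: divide_le_eq_1)
  have "(\<Sum>f\<in>H'. w' f) \<le> 1 * (\<Sum>f\<in>H. w f)"
    using restrict ratio finH fin_N by (intro bound[where M = N]) auto
  with IH have total: "(\<Sum>f\<in>H'. w' f) \<le> 1" by simp
  \<comment> \<open>A non-injective extension either restricts to a non-injective copy, or sends
    \<open>t\<close> to one of the at most \<open>card W\<close> vertices used already.\<close>
  define X1 where "X1 = {f\<in>bad'. restrict f W \<in> bad}"
  define X2 where "X2 = {f\<in>bad'. restrict f W \<notin> bad}"
  have bad'_H': "bad' \<subseteq> H'" by (auto simp: bad'_def H'_def)
  have "(\<Sum>f\<in>X1. w' f) \<le> 1 * (\<Sum>f\<in>bad. w f)"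
    using restrict bad'_H' ratio finH fin_N by (intro bound[where M = N]) (auto simp: X1_def)
  moreover have "(\<Sum>f\<in>X2. w' f) \<le> (card W / D) * (\<Sum>f\<in>H. w f)"
  proof (rule bound[where M = "\<lambda>f. f ` W"])
    fix f assume f: "f \<in> X2"
    then have fH': "f \<in> H'" using bad'_H' by (auto simp: X2_def)
    have "inj_on (restrict f W) W"
      using f restrict(1)[OF fH'] by (auto simp: X2_def bad_def H_def)
    then have "inj_on f W" by (simp add: inj_on_restrict_eq)
    then have "f t \<in> f ` W" using f step.hyps(3) by (auto simp: X2_def bad'_def)
    then show "restrict f W \<in> H \<and> f t \<in> restrict f W ` W" using restrict(1)[OF fH'] by simp
  next
    fix f assume "f \<in> H"
    then show "card (f ` W) / coldeg {s, t} (f s) \<le> card W / D"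
      using coldeg[of f] D(1) card_image_le[OF finW, of f] by (intro frac_le) (auto simp: H_def)
  qed (use bad'_H' finH finW in \<open>auto simp: X2_def\<close>)
  moreover have "(card W / D) * (\<Sum>f\<in>H. w f) \<le> (card W / D) * 1"
    using IH(1) by (intro mult_left_mono) auto
  moreover have "(\<Sum>f\<in>bad'. w' f) = (\<Sum>f\<in>X1. w' f) + (\<Sum>f\<in>X2. w' f)"
    using finH by (subst sum.union_disjoint[symmetric]) (auto simp: X1_def X2_def intro: sum.cong)
  ultimately have "(\<Sum>f\<in>bad'. w' f) \<le> (card W)\<^sup>2 / real D + card W / D"
    using IH(2) by simp
  also have "\<dots> = ((card W)\<^sup>2 + card W) / real D" by (simp add: add_divide_distrib)
  \<comment> \<open>With \<open>k = card W\<close>, this is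
    \<open>k^2 + k \<le> (k + 1)^2\<close>.\<close>
  also have "\<dots> \<le> (card (insert t W))\<^sup>2 / real D"
    using finW step.hyps(3) by (intro divide_right_mono) (auto simp: power2_eq_square algebra_simps)
  finally show ?case using total by (simp add: H'_def bad'_def w'_def)
qed

section \<open>Application of the local lemma\<close>

text \<open>The events are the non-injective copies; dependence means sharing the image of a tree
  edge. Each of the \<open>card ET\<close> shared edges carries non-injective weight at most
  \<open>(card VT)\<^sup>2 / D\<close>. As \<open>card VT\<close> is at most
  \<open>2 * card ET\<close>, the sum is at most \<open>4 * card ET ^ 3 / D\<close>, hence at most
  1/4.\<close>

lemma exists_injective_pdec:
  assumes ne: "ET \<noteq> {}"
    and D: "\<And>v j. v \<in> VG \<Longrightarrow> j \<in> ET \<Longrightarrow> D \<le> coldeg j v" "16 * card ET ^ 3 \<le> D"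
  shows "\<exists>P\<in>pdecs VT. \<forall>f\<in>P. inj_on f VT"
proof -
  define B where "B = {f\<in>homs VT. \<not> inj_on f VT}"
  define dep where "dep f g \<longleftrightarrow> (\<exists>j\<in>ET. g ` j = f ` j)" for f g :: "'t \<Rightarrow> 'v"
  have "\<exists>w a b. j = {a, b} \<and> grow a b VT w" if "j \<in> ET" for j
    using grow_VT that ET_card[OF that] by (metis card_2_iff)
  then obtain w where w: "\<And>j. j \<in> ET \<Longrightarrow> \<exists>a b. j = {a, b} \<and> grow a b VT (w j)"
    by metis
  \<comment> \<open>The lopsided bound holds for the weight grown from any tree edge, hence for the
    minimum. This allows the sum over dependent copies to be split by the shared edge, each part
    using the weight grown from that edge.\<close>
  define p where "p f = Min ((\<lambda>j. w j f) ` ET)" for f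
  have p_le: "p f \<le> w j f" if "j \<in> ET" for f j
    unfolding p_def using that finite_ET by auto
  have p_eq: "\<exists>j\<in>ET. p f = w j f" for f
  proof -
    have "p f \<in> (\<lambda>j. w j f) ` ET" unfolding p_def using finite_ET ne by (intro Min_in) auto
    then show ?thesis by auto
  qed
  have w_nonneg: "0 \<le> w j f" if "j \<in> ET" for j f using w[OF that] grow_nonneg by auto
  obtain j where j: "j \<in> ET" using ne by auto
  have finB: "finite B" using finite_homs[of VT] by (simp add: B_def)
  have m: "card ET > 0" using ne finite_ET by (simp add: card_gt_0_iff)
  have D_pos: "D > 0" using D(2) m by (metis gr_zeroI le_zero_eq mult_is_0 power_eq_0_iff zero_neq_numeral)
  have "card VT \<le> (\<Sum>j\<in>ET. card j)" using card_Union_le_sum_card[of ET] Union_ET[OF ne] by simp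
  also have "\<dots> = 2 * card ET" using ET_card by simp
  finally have card_VT: "card VT \<le> 2 * card ET" .
  have "\<exists>P\<in>pdecs VT. \<forall>f\<in>B. f \<notin> P"
  proof (rule counting_local_lemma[where p = p and dep = dep])
    show "finite (pdecs VT)" by (rule finite_pdecs)
    show "pdecs VT \<noteq> {}" using w[OF j] pdecs_nonempty j by auto
    show "0 \<le> p f" for f using p_eq[of f] w_nonneg by auto
    show "dep f f" for f using j by (auto simp: dep_def)
    fix f assume f: "f \<in> B"
    show "real (card {P\<in>pdecs VT. f \<in> P \<and> (\<forall>g\<in>S. g \<notin> P)})
        \<le> p f * card {P\<in>pdecs VT. \<forall>g\<in>S. g \<notin> P}"
      if S: "S \<subseteq> B" "\<forall>g\<in>S. \<not> dep f g" for S
    proof -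
      obtain i where i: "i \<in> ET" "p f = w i f" using p_eq by auto
      obtain a b where ab: "i = {a, b}" "grow a b VT (w i)" using w[OF i(1)] by auto
      have fH: "f \<in> homs VT" using f by (simp add: B_def)
      have "real (card {P\<in>pdecs VT. P \<inter> S = {} \<and> (\<exists>g\<in>P. \<forall>x\<in>VT. g x = f x)})
          \<le> w i f * card {P\<in>pdecs VT. P \<inter> S = {}}"
        using i(1) ab fH S(2) by (intro swapping_bound[of a b]) (auto simp: dep_def)
      moreover have "(\<exists>g\<in>P. \<forall>x\<in>VT. g x = f x) \<longleftrightarrow> f \<in> P" if "P \<in> pdecs VT" for P
      proof
        assume "\<exists>g\<in>P. \<forall>x\<in>VT. g x = f x"
        then obtain g where g: "g \<in> P" "\<forall>x\<in>VT. g x = f x" by blast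
        then have "g = f" using homs_ext[OF _ fH, of g] that by (auto simp: pdecs_def)
        with g show "f \<in> P" by simp
      qed blast
      then have "{P\<in>pdecs VT. P \<inter> S = {} \<and> (\<exists>g\<in>P. \<forall>x\<in>VT. g x = f x)}
          = {P\<in>pdecs VT. f \<in> P \<and> (\<forall>g\<in>S. g \<notin> P)}" by blast
      moreover have "{P\<in>pdecs VT. P \<inter> S = {}} = {P\<in>pdecs VT. \<forall>g\<in>S. g \<notin> P}" by blast
      ultimately show ?thesis using i by simp
    qed
    have "(\<Sum>g\<in>{g\<in>B. dep f g}. p g)
        \<le> (\<Sum>g\<in>B. \<Sum>j\<in>ET. if g ` j = f ` j then w j g else 0)"
    proof (rule order_trans[OF sum_mono sum_mono2])
      fix g assume "g \<in> {g\<in>B. dep f g}"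
      then obtain i where i: "i \<in> ET" "g ` i = f ` i" by (auto simp: dep_def)
      have "p g \<le> (if g ` i = f ` i then w i g else 0)" using p_le i by simp
      also have "\<dots> \<le> (\<Sum>j\<in>ET. if g ` j = f ` j then w j g else 0)"
        using i finite_ET w_nonneg
        by (intro member_le_sum[of i ET "\<lambda>j. if g ` j = f ` j then w j g else 0"]) auto
      finally show "p g \<le> (\<Sum>j\<in>ET. if g ` j = f ` j then w j g else 0)" .
    qed (use finB w_nonneg in \<open>auto intro: sum_nonneg\<close>)
    also have "\<dots> = (\<Sum>j\<in>ET. \<Sum>g\<in>{g\<in>B. g ` j = f ` j}. w j g)"
      using finB by (subst sum.swap) (simp add: sum.inter_filter)
    also have "\<dots> \<le> (\<Sum>j\<in>ET. (card VT)\<^sup>2 / real D)"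
    proof (rule sum_mono)
      fix j assume j: "j \<in> ET"
      obtain a b where ab: "j = {a, b}" "grow a b VT (w j)" using w[OF j] by auto
      have "{g\<in>B. g ` j = f ` j} = {g\<in>homs VT. g ` {a, b} = f ` j \<and> \<not> inj_on g VT}"
        using ab by (auto simp: B_def)
      then show "(\<Sum>g\<in>{g\<in>B. g ` j = f ` j}. w j g) \<le> (card VT)\<^sup>2 / real D"
        using weight_sum[OF ab(2) _ D_pos D(1), of "f ` j"] j ab(1) by simp
    qed
    also have "\<dots> = real (card ET * (card VT)\<^sup>2) / real D" by simp
    also have "\<dots> \<le> real (4 * card ET ^ 3) / real D"
    proof (intro divide_right_mono of_nat_mono)
      have "card ET * (card VT)\<^sup>2 \<le> card ET * (2 * card ET)\<^sup>2"
        using card_VT by (intro mult_left_mono power_mono) auto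
      then show "card ET * (card VT)\<^sup>2 \<le> 4 * card ET ^ 3"
        by (simp add: power2_eq_square power3_eq_cube)
    qed simp
    also have "\<dots> \<le> 1/4"
    proof -
      have "real (16 * card ET ^ 3) \<le> real D" using D(2) by (rule of_nat_mono)
      then show ?thesis using D_pos by (simp add: divide_le_eq)
    qed
    finally show "(\<Sum>g\<in>{g\<in>B. dep f g}. p g) \<le> 1/4" .
  qed (rule finB)
  then obtain P where P: "P \<in> pdecs VT" "\<forall>f\<in>B. f \<notin> P" by blast
  moreover have "P \<subseteq> homs VT" using P(1) by (simp add: pdecs_def)
  ultimately have "\<forall>f\<in>P. inj_on f VT" by (auto simp: B_def)
  with P(1) show ?thesis by blast
qed

section \<open>From injective copies to the decomposition\<close>

text \<open>Each injective copy is an isomorphism onto its image. An edge common to two images has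
  one colour, so it is the image of the same tree edge under both maps, and the maps
  coincide.\<close>

lemma T_decomposition_if_injective:
  assumes ne: "ET \<noteq> {}" and P: "P \<in> pdecs VT" and inj: "\<And>f. f \<in> P \<Longrightarrow> inj_on f VT"
  shows "T_decomposition VT ET EG ((\<lambda>f. (`) f ` ET) ` P)"
proof -
  have PH: "f \<in> homs VT" if "f \<in> P" for f using that P by (auto simp: pdecs_def)
  have edge: "f ` j \<in> EG" "\<phi> (f ` j) = j" if "f \<in> P" "j \<in> ET" for f j
    using homs_edge[OF PH[OF that(1)] that(2)] homs_col[OF PH[OF that(1)] that(2)]
      ET_subset[OF that(2)] by auto
  note UnET = Union_ET[OF ne]
  have "iso_to VT ET ((`) f ` ET)" if f: "f \<in> P" for f
    unfolding iso_to_def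
  proof (intro exI conjI ballI)
    \<comment> \<open>\<open>iso_to\<close> speaks of the vertices covered by edges; without
      isolated tree vertices these form the whole image of \<open>VT\<close>.\<close>
    have "\<Union>((`) f ` ET) = f ` VT" unfolding UnET[symmetric] by blast
    then show "bij_betw f VT (\<Union>((`) f ` ET))" using inj[OF f] by (simp add: bij_betw_def)
    fix x y assume xy: "x \<in> VT" "y \<in> VT"
    show "{x, y} \<in> ET \<longleftrightarrow> {f x, f y} \<in> (`) f ` ET"
    proof
      assume "{f x, f y} \<in> (`) f ` ET"
      then obtain j where j: "j \<in> ET" "f ` {x, y} = f ` j" by auto
      then have "{x, y} = j" using inj_on_image_eq_iff[OF inj[OF f]] ET_subset xy by (metis empty_subsetI insert_subset)
      then show "{x, y} \<in> ET" using j by simp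
    next
      assume "{x, y} \<in> ET"
      then show "{f x, f y} \<in> (`) f ` ET" by (intro image_eqI[of _ _ "{x, y}"]) auto
    qed
  qed
  moreover have "partition_on EG ((\<lambda>f. (`) f ` ET) ` P)"
  proof (rule partition_onI)
    show "\<Union>((\<lambda>f. (`) f ` ET) ` P) = EG"
    proof (intro equalityI subsetI)
      fix e assume e: "e \<in> EG"
      obtain f where f: "f \<in> P" "f ` \<phi> e = e"
        using pdecs_cover[OF P e ET_subset[OF col_in_ET[OF e]]] .
      have "e \<in> (`) f ` ET" using imageI[OF col_in_ET[OF e], of "(`) f"] f(2) by simp
      then show "e \<in> \<Union>((\<lambda>f. (`) f ` ET) ` P)" using f(1) by blast
    qed (use edge(1) in auto)
    show "{} \<notin> (\<lambda>f. (`) f ` ET) ` P" using ne by auto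
    fix p q assume pq: "p \<in> (\<lambda>f. (`) f ` ET) ` P" "q \<in> (\<lambda>f. (`) f ` ET) ` P" "p \<noteq> q"
    then obtain f g where fg: "f \<in> P" "g \<in> P" "p = (`) f ` ET" "q = (`) g ` ET" by auto
    show "disjnt p q"
    proof (rule ccontr)
      assume "\<not> disjnt p q"
      then obtain i j where ij: "i \<in> ET" "j \<in> ET" "f ` i = g ` j" using fg by (auto simp: disjnt_def)
      have "i = j" using edge(2)[OF fg(1) ij(1)] edge(2)[OF fg(2) ij(2)] ij(3) by simp
      then have "f = g" using pdecs_unique[OF P fg(1,2) ij(1)] ET_subset ij by simp
      then show False using fg pq by simp
    qed
  qed
  ultimately show ?thesis by (auto simp: T_decomposition_def)
qed

end

theorem theorem5:
  fixes VT :: "'t set" and ET :: "'t set set" and TA TB :: "'t set"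
    and VG :: "'v set" and EG :: "'v set set" and A B :: "'v set"
    and \<phi> :: "'v set \<Rightarrow> 't set" and m :: nat
  assumes "tree VT ET" and "card ET = m" and "bipartition VT ET TA TB"
    and "simple_graph VG EG" and "bipartition VG EG A B"
    and "T_equitable VG EG A B VT ET TA TB \<phi>"
    and "\<forall>v\<in>VG. \<forall>j\<in>ET. col_deg EG \<phi> j v \<ge> 10 ^ (50 * m)"
  shows "\<exists>P. T_decomposition VT ET EG P"
proof -
  interpret equitable_colouring VT ET TA TB VG EG A B \<phi>
    by unfold_locales fact+
  show ?thesis
  proof (cases "ET = {}")
    case True
    \<comment> \<open>The one-vertex tree provides no colours, so the graph has no edges and the
      empty partition works.\<close>
    then have "EG = {}" using col_in_ET by auto
    then have "T_decomposition VT ET EG {}" by (simp add: T_decomposition_def partition_on_empty)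
    then show ?thesis by blast
  next
    case False
    have "16 * card ET ^ 3 \<le> 10 ^ (50 * m)"
    proof -
      have "m > 0" using False finite_ET assms(2) by (auto simp: card_gt_0_iff)
      \<comment> \<open>From \<open>m \<ge> 1\<close> and \<open>m \<le> 2 ^ m\<close> the left side
        is at most \<open>128 ^ m\<close>, far below \<open>10 ^ (50 * m)\<close>.\<close>
      have "16 * card ET ^ 3 \<le> 16 ^ m * (2 ^ m) ^ 3"
        using \<open>m > 0\<close> less_exp[of m] assms(2)
        by (intro mult_mono power_mono self_le_power) auto
      also have "\<dots> = (16 * 2 ^ 3) ^ m"
        unfolding power_mult_distrib power_mult[symmetric] by (simp add: mult.commute)
      also have "\<dots> \<le> (10 ^ 50) ^ m" by (intro power_mono) auto
      finally show ?thesis by (simp add: power_mult)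
    qed
    then obtain P where "P \<in> pdecs VT" "\<forall>f\<in>P. inj_on f VT"
      using exists_injective_pdec[OF False, of "10 ^ (50 * m)"] assms(7) by auto
    then show ?thesis using T_decomposition_if_injective[OF False] by blast
  qed
qed

end
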